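(* Let $G$ be a non-complete graph on $n$ vertices and let $\overline{G}$ denote its complement. Then $$\mathrm{box}(G)\ge \frac{|E(\overline{G})|}{\sum_{i=1}^{n-1} c_v(i,\overline{G})}.$$
   Context: Graphs are finite, simple and undirected. The boxicity $\mathrm{box}(G)$ is the minimum $k$ such that there are interval graphs $I_1,\dots,I_k$ on $V(G)$ with $E(G)=E(I_1)\cap\cdots\cap E(I_k)$ (equivalently, the minimum dimension $b$ such that $G$ is an intersection graph of axis-parallel boxes in $\mathbb{R}^b$). For a graph $H=(V,E)$ and $X\subseteq V$, the strong vertex-boundary is $\mathrm{sn}(X,H)=\{u\in V\setminus X : uv\in E \text{ for all } v\in X\}$, and for a positive integer $k$, $c_v(k,H)=\max_{X\subseteq V,\,|X|=k}|\mathrm{sn}(X,H)|$. *)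

theory Defs
  imports Complex_Main
begin

text \<open>A graph is given by its vertex set and its set of edges, each edge a two-element set
  of vertices.\<close>

definition all_pairs :: "'a set \<Rightarrow> 'a set set" where
  "all_pairs V = {e. e \<subseteq> V \<and> card e = 2}"

definition simple_graph :: "'a set \<Rightarrow> 'a set set \<Rightarrow> bool" where
  "simple_graph V E \<longleftrightarrow> finite V \<and> E \<subseteq> all_pairs V"

definition complete_graph :: "'a set \<Rightarrow> 'a set set \<Rightarrow> bool" where
  "complete_graph V E \<longleftrightarrow> simple_graph V E \<and> E = all_pairs V"

definition complement_edges :: "'a set \<Rightarrow> 'a set set \<Rightarrow> 'a set set" where
  "complement_edges V E = all_pairs V - E"

text \<open>Intervals are nonempty, closed and bounded.\<close>

definition interval_graph :: "'a set \<Rightarrow> 'a set set \<Rightarrow> bool" where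
  "interval_graph V E \<longleftrightarrow> simple_graph V E \<and>
     (\<exists>l r :: 'a \<Rightarrow> real. (\<forall>v\<in>V. l v \<le> r v) \<and>
        (\<forall>u\<in>V. \<forall>v\<in>V. u \<noteq> v \<longrightarrow>
           ({u, v} \<in> E \<longleftrightarrow> {l u..r u} \<inter> {l v..r v} \<noteq> {})))"

text \<open>The intersection is taken inside \<open>all_pairs V\<close>, so that the empty intersection is the
  complete graph, which thus has boxicity 0.\<close>

definition box_representable :: "'a set \<Rightarrow> 'a set set \<Rightarrow> nat \<Rightarrow> bool" where
  "box_representable V E k \<longleftrightarrow>
     (\<exists>I :: nat \<Rightarrow> 'a set set. (\<forall>i<k. interval_graph V (I i)) \<and>
        E = all_pairs V \<inter> (\<Inter>i<k. I i))"

definition boxicity :: "'a set \<Rightarrow> 'a set set \<Rightarrow> nat" where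
  "boxicity V E = (LEAST k. box_representable V E k)"

definition sn :: "'a set \<Rightarrow> 'a set \<Rightarrow> 'a set set \<Rightarrow> 'a set" where
  "sn X V E = {u \<in> V - X. \<forall>v\<in>X. {u, v} \<in> E}"

text \<open>Meaningful for \<open>1 \<le> k \<le> card V\<close> only: for larger \<open>k\<close> the maximum ranges over the empty
  set.\<close>

definition c_v :: "nat \<Rightarrow> 'a set \<Rightarrow> 'a set set \<Rightarrow> nat" where
  "c_v k V E = Max {card (sn X V E) | X. X \<subseteq> V \<and> card X = k}"

text \<open>Every graph has a representation, so the minimum defining the boxicity exists: each
  non-edge \<open>{u, v}\<close> is excluded by the interval graph in which \<open>u\<close> and \<open>v\<close> are disjoint points
  and every other vertex is an interval containing both.\<close>

lemma interval_graph_all_but_one: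
  assumes "finite V" "e \<in> all_pairs V"
  shows "interval_graph V (all_pairs V - {e})"
proof -
  from assms(2) obtain a b where e: "e = {a, b}" "a \<noteq> b"
    by (auto simp: all_pairs_def card_2_iff)
  let ?l = "\<lambda>x. if x = b then 1 else (0::real)"
  let ?r = "\<lambda>x. if x = a then 0 else (1::real)"
  have "{u, v} \<in> all_pairs V - {e} \<longleftrightarrow> {?l u..?r u} \<inter> {?l v..?r v} \<noteq> {}"
    if "u \<in> V" "v \<in> V" "u \<noteq> v" for u v
  proof -
    have "{u, v} \<in> all_pairs V - {e} \<longleftrightarrow> \<not> (u = a \<and> v = b \<or> u = b \<and> v = a)"
      using that by (simp add: e(1) all_pairs_def doubleton_eq_iff)
    also have "\<dots> \<longleftrightarrow> max (?l u) (?l v) \<le> min (?r u) (?r v)"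
      using that(3) e(2) by simp
    also have "\<dots> \<longleftrightarrow> {?l u..?r u} \<inter> {?l v..?r v} \<noteq> {}"
      by (simp only: Int_atLeastAtMost atLeastatMost_empty_iff2 atLeastatMost_empty_iff not_not
          sup_max inf_min)
    finally show ?thesis .
  qed
  moreover have "?l v \<le> ?r v" for v using e(2) by simp
  ultimately have "\<exists>l r :: 'a \<Rightarrow> real. (\<forall>v\<in>V. l v \<le> r v) \<and>
      (\<forall>u\<in>V. \<forall>v\<in>V. u \<noteq> v \<longrightarrow>
         ({u, v} \<in> all_pairs V - {e} \<longleftrightarrow> {l u..r u} \<inter> {l v..r v} \<noteq> {}))"
    by (intro exI[of _ ?l] exI[of _ ?r] conjI ballI impI)
  then show ?thesis
    using assms(1) unfolding interval_graph_def simple_graph_def by (intro conjI) auto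
qed

lemma box_representable_exists:
  assumes "simple_graph V E"
  shows "\<exists>k. box_representable V E k"
proof -
  have fin: "finite V" and sub: "E \<subseteq> all_pairs V"
    using assms by (auto simp: simple_graph_def)
  have "finite (all_pairs V)"
    by (rule finite_subset[of _ "Pow V"]) (auto simp: all_pairs_def fin)
  then have "finite (complement_edges V E)" by (simp add: complement_edges_def)
  from finite_imp_nat_seg_image_inj_on[OF this]
  obtain g and k :: nat where g: "complement_edges V E = g ` {i. i < k}" by (elim exE conjE)
  let ?I = "\<lambda>i. all_pairs V - {g i}"
  have "\<forall>i<k. interval_graph V (?I i)"
  proof (intro allI impI)
    fix i assume "i < k"
    then have "g i \<in> complement_edges V E" unfolding g by simp
    then show "interval_graph V (?I i)"
      by (intro interval_graph_all_but_one fin) (simp add: complement_edges_def)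
  qed
  moreover have "E = all_pairs V \<inter> (\<Inter>i<k. ?I i)"
  proof -
    have "all_pairs V \<inter> (\<Inter>i<k. ?I i) = all_pairs V - g ` {i. i < k}" by auto
    also have "\<dots> = E" using sub unfolding g[symmetric] complement_edges_def by blast
    finally show ?thesis ..
  qed
  ultimately show ?thesis
    unfolding box_representable_def by (intro exI[of _ k] exI[of _ ?I]) simp
qed

end

theory Submission
  imports Defs
begin

text \<open>Each of the \<open>box(G)\<close> interval graphs of a representation has few non-edges. List the vertices
  by increasing right endpoint. A non-edge consists of a vertex \<open>u\<close> whose interval ends before that
  of \<open>v\<close> begins; if \<open>u\<close> is the \<open>i\<close>-th vertex of the list, then the intervals of the first \<open>i\<close>
  vertices all end before that of \<open>v\<close> begins, so \<open>v\<close> lies in the strong vertex-boundary of these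
  \<open>i\<close> vertices in the complement. Hence at most \<open>c\<^sub>v(i)\<close> non-edges belong to \<open>u\<close>. Every
  non-edge of \<open>G\<close> is a non-edge of one of the interval graphs.\<close>

lemma card_sn_le_c_v:
  assumes "finite V" "X \<subseteq> V"
  shows "card (sn X V E) \<le> c_v (card X) V E"
proof -
  have "finite {card (sn Y V E) | Y. Y \<subseteq> V \<and> card Y = card X}"
    by (rule finite_subset[of _ "(\<lambda>Y. card (sn Y V E)) ` Pow V"]) (use assms(1) in auto)
  then show ?thesis
    unfolding c_v_def using assms(2) by (intro Max_ge) auto
qed

lemma sn_mono: "E \<subseteq> F \<Longrightarrow> sn X V E \<subseteq> sn X V F"
  by (auto simp: sn_def)

lemma interval_complement_edge_iff:
  fixes l r :: "'a \<Rightarrow> real"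
  assumes "\<forall>v\<in>V. l v \<le> r v"
    and "\<forall>u\<in>V. \<forall>v\<in>V. u \<noteq> v \<longrightarrow> ({u, v} \<in> E \<longleftrightarrow> {l u..r u} \<inter> {l v..r v} \<noteq> {})"
    and "u \<in> V" "v \<in> V"
  shows "{u, v} \<in> complement_edges V E \<longleftrightarrow> r u < l v \<or> r v < l u"
proof (cases "u = v")
  \<comment> \<open>Both sides fail: \<open>{u, u}\<close> has only one element, and
    \<open>r u < l u\<close> would make the interval of \<open>u\<close> empty.\<close>
  case True
  then show ?thesis
    using bspec[OF assms(1) assms(3)] by (simp add: complement_edges_def all_pairs_def)
next
  case False
  then have "{u, v} \<in> complement_edges V E \<longleftrightarrow> {l u..r u} \<inter> {l v..r v} = {}"
    using bspec[OF bspec[OF assms(2,3)] assms(4)] assms(3,4)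
    by (simp add: complement_edges_def all_pairs_def del: Int_atLeastAtMost)
  also have "\<dots> \<longleftrightarrow> \<not> max (l u) (l v) \<le> min (r u) (r v)"
    by (simp only: Int_atLeastAtMost atLeastatMost_empty_iff sup_max inf_min)
  \<comment> \<open>Comparing \<open>max\<close> with \<open>min\<close> amounts to four
    inequalities; the two that involve a single vertex hold because intervals are nonempty.\<close>
  also have "\<dots> \<longleftrightarrow> r u < l v \<or> r v < l u"
    using bspec[OF assms(1) assms(3)] bspec[OF assms(1) assms(4)] by auto
  finally show ?thesis .
qed

text \<open>The superset \<open>F\<close> lets the bound be stated with the complement of the
  represented graph, although the non-edges counted are those of one interval graph: strong
  boundaries only grow with the edge set.\<close>

lemma card_complement_interval_graph_le:
  assumes "interval_graph V E" and sub: "complement_edges V E \<subseteq> F"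
  shows "card (complement_edges V E) \<le> (\<Sum>i = 1..card V - 1. c_v i V F)"
proof -
  from assms(1) obtain l r :: "'a \<Rightarrow> real" where fin: "finite V"
    and lr: "\<forall>v\<in>V. l v \<le> r v"
    and E: "\<forall>u\<in>V. \<forall>v\<in>V. u \<noteq> v \<longrightarrow> ({u, v} \<in> E \<longleftrightarrow> {l u..r u} \<inter> {l v..r v} \<noteq> {})"
    unfolding interval_graph_def simple_graph_def by blast
  note nonedge = interval_complement_edge_iff[OF lr E]
  from fin obtain ys where "set ys = V" "distinct ys"
    using finite_distinct_list by blast
  then obtain xs where xs: "set xs = V" "distinct xs" "sorted (map r xs)"
    using that[of "sort_key r ys"] by simp
  have len: "length xs = card V" using xs(1,2) distinct_card by metis
  have mono: "r (xs ! j) \<le> r (xs ! i)" if "j \<le> i" "i < card V" for i j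
    using sorted_nth_mono[OF xs(3) that(1)] that len by simp
  \<comment> \<open>Lists are indexed from 0, so \<open>xs ! (i - 1)\<close> is the
    \<open>i\<close>-th vertex; \<open>B i\<close> collects its partners in the non-edges charged to
    it.\<close>
  define B where "B i = {v \<in> V. r (xs ! (i - 1)) < l v}" for i
  have cover: "complement_edges V E \<subseteq> (\<Union>i\<in>{1..card V - 1}. (\<lambda>v. {xs ! (i - 1), v}) ` B i)"
  proof
    fix e assume e: "e \<in> complement_edges V E"
    then obtain a b where ab: "e = {a, b}" "a \<in> V" "b \<in> V"
      by (auto simp: complement_edges_def all_pairs_def card_2_iff)
    then have "r a < l b \<or> r b < l a" using e nonedge by blast
    moreover have "e = {b, a}" using ab(1) by blast
    ultimately obtain u v where uv: "e = {u, v}" "u \<in> V" "v \<in> V" "r u < l v"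
      using ab by blast
    obtain j k where j: "u = xs ! j" "j < card V" and k: "v = xs ! k" "k < card V"
      using uv(2,3) xs(1) len by (metis in_set_conv_nth)
    \<comment> \<open>Since \<open>v\<close> ends strictly after \<open>u\<close>, the vertex
      \<open>u\<close> is not last in the list; this is why the sum can stop at
      \<open>card V - 1\<close>.\<close>
    have "r u < r v" using uv(4) bspec[OF lr uv(3)] by linarith
    then have "j < k" using mono[of k j] j k by (meson leI not_less)
    then have "Suc j \<in> {1..card V - 1}" using k by auto
    moreover have "e \<in> (\<lambda>v. {xs ! (Suc j - 1), v}) ` B (Suc j)"
      using uv j by (auto simp: B_def)
    ultimately show "e \<in> (\<Union>i\<in>{1..card V - 1}. (\<lambda>v. {xs ! (i - 1), v}) ` B i)" by blast
  qed
  have bound: "card (B i) \<le> c_v i V F" if i: "i \<in> {1..card V - 1}" for i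
  proof -
    let ?X = "set (take i xs)"
    have X: "?X \<subseteq> V" using set_take_subset[of i xs] xs(1) by simp
    have "length (take i xs) = i" using i len by auto
    then have card_X: "card ?X = i" using distinct_card[OF distinct_take[OF xs(2)]] by simp
    have "B i \<subseteq> sn ?X V (complement_edges V E)"
    proof
      fix v assume "v \<in> B i"
      then have v: "v \<in> V" "r (xs ! (i - 1)) < l v" by (auto simp: B_def)
      have less: "r w < l v" if "w \<in> ?X" for w
      proof -
        obtain j where "w = xs ! j" "j < i" using \<open>w \<in> ?X\<close> by (auto simp: in_set_conv_nth)
        moreover have "j \<le> i - 1" "i - 1 < card V" using \<open>j < i\<close> i by auto
        ultimately show ?thesis using mono[of j "i - 1"] v(2) by simp
      qed
      \<comment> \<open>Were \<open>v\<close> in \<open>?X\<close>, its own interval would end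
        before it begins.\<close>
      have "v \<notin> ?X" using less[of v] bspec[OF lr v(1)] by linarith
      then show "v \<in> sn ?X V (complement_edges V E)"
        unfolding sn_def using v(1) less X nonedge by blast
    qed
    also have "\<dots> \<subseteq> sn ?X V F" by (rule sn_mono[OF sub])
    finally have "card (B i) \<le> card (sn ?X V F)"
      by (rule card_mono[rotated]) (simp add: sn_def fin)
    also have "\<dots> \<le> c_v i V F" using card_sn_le_c_v[OF fin X] card_X by simp
    finally show ?thesis .
  qed
  have finB: "finite (B i)" for i using fin by (simp add: B_def)
  have "card (complement_edges V E) \<le> card (\<Union>i\<in>{1..card V - 1}. (\<lambda>v. {xs ! (i - 1), v}) ` B i)"
    using cover by (rule card_mono[rotated]) (use finB in auto)
  also have "\<dots> \<le> (\<Sum>i = 1..card V - 1. card ((\<lambda>v. {xs ! (i - 1), v}) ` B i))"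
    by (rule card_UN_le) simp
  also have "\<dots> \<le> (\<Sum>i = 1..card V - 1. c_v i V F)"
    by (intro sum_mono le_trans[OF card_image_le[OF finB]] bound)
  finally show ?thesis .
qed

lemma card_complement_le_box_representable:
  assumes "simple_graph V E" "box_representable V E k"
  shows "card (complement_edges V E) \<le>
    k * (\<Sum>i = 1..card V - 1. c_v i V (complement_edges V E))"
proof -
  from assms(2) obtain I where I: "\<forall>i<k. interval_graph V (I i)"
    and E: "E = all_pairs V \<inter> (\<Inter>i<k. I i)"
    unfolding box_representable_def by blast
  \<comment> \<open>De Morgan inside \<open>all_pairs V\<close>; for \<open>k = 0\<close> both sides
    are empty.\<close>
  have "complement_edges V E = (\<Union>i<k. complement_edges V (I i))"
    unfolding E complement_edges_def by auto
  then have "card (complement_edges V E) \<le> (\<Sum>i<k. card (complement_edges V (I i)))"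
    by (simp add: card_UN_le)
  also have "\<dots> \<le> (\<Sum>i<k. \<Sum>i = 1..card V - 1. c_v i V (complement_edges V E))"
  proof (intro sum_mono card_complement_interval_graph_le)
    fix i assume "i \<in> {..<k}"
    then show "interval_graph V (I i)" "complement_edges V (I i) \<subseteq> complement_edges V E"
      using I unfolding E complement_edges_def by auto
  qed
  finally show ?thesis by simp
qed

theorem theorem2:
  fixes V :: "'a set" and E :: "'a set set" and n :: nat
  assumes "simple_graph V E"
    and "card V = n"
    and "\<not> complete_graph V E"
  shows "real (boxicity V E) \<ge>
    real (card (complement_edges V E)) /
      (\<Sum>i = 1..n - 1. real (c_v i V (complement_edges V E)))"
proof -
  let ?S = "\<Sum>i = 1..n - 1. c_v i V (complement_edges V E)"
  have "box_representable V E (boxicity V E)"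
    unfolding boxicity_def using box_representable_exists[OF assms(1)] by (rule LeastI_ex)
  from card_complement_le_box_representable[OF assms(1) this]
  have "card (complement_edges V E) \<le> boxicity V E * ?S" unfolding assms(2) .
  then have "real (card (complement_edges V E)) \<le> real (boxicity V E) * real ?S"
    by (metis of_nat_le_iff of_nat_mult)
  \<comment> \<open>If the sum is 0, the quotient is 0 by the convention for division by 0.\<close>
  then have "real (card (complement_edges V E)) / real ?S \<le> real (boxicity V E)"
    by (cases "real ?S > 0") (simp_all only: pos_divide_le_eq of_nat_0_less_iff not_gr_zero
        of_nat_0 div_by_0 of_nat_0_le_iff)
  then show ?thesis by simp
qed

end
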